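(* A Tychonoff space $Y$ has the weak Skorohod property if and only if there is a subproper map $f:X\to Y$ from a space $X$ possessing the weak Skorohod property.
   Context: All topological spaces are Hausdorff; "map" means continuous function. A subset is precompact if its closure is compact. A map $f:X\to Y$ is subproper if there is $Z\subset X$ with $f(Z)=Y$ such that $Z\cap f^{-1}(K)$ is precompact in $X$ for every precompact $K\subset Y$. A Borel probability measure $\mu$ on $X$ is Radon if for every $\varepsilon>0$ and every Borel $B\subset X$ there is a compact $K\subset B$ with $\mu(B\setminus K)<\varepsilon$. $P_r(X)$ is the set of all Radon Borel probability measures on $X$. A family $\mathcal M\subset P_r(X)$ is uniformly tight if for every $\varepsilon>0$ there is a compact $K_\varepsilon\subset X$ with $\mu(X\setminus K_\varepsilon)<\varepsilon$ for all $\mu\in\mathcal M$. A space $X$ has the weak Skorohod property if to each $\mu\in P_r(X)$ one can assign a Borel function $\xi_\mu:[0,1]\to X$ such that $\mu$ is the image of Lebesgue measure $\lambda$ on $[0,1]$ under $\xi_\mu$ and for every uniformly tight sequence $(\mu_n)\subset P_r(X)$ the function sequence $(\xi_{\mu_n})$ contains a subsequence that converges in $X$ almost surely with respect to $\lambda$. *)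

theory Defs
  imports "HOL-Probability.Probability"
begin

text \<open>
  Spaces are abstract topologies (a carrier set inside a type), so that "there is a space X"
  is an honest existential quantification.
\<close>

definition borel_of :: "'a topology \<Rightarrow> 'a measure" where
  "borel_of X = sigma (topspace X) {U. openin X U}"

definition precompact_in :: "'a topology \<Rightarrow> 'a set \<Rightarrow> bool" where
  "precompact_in X S \<longleftrightarrow> S \<subseteq> topspace X \<and> compactin X (X closure_of S)"

definition subproper_map :: "'a topology \<Rightarrow> 'b topology \<Rightarrow> ('a \<Rightarrow> 'b) \<Rightarrow> bool" where
  "subproper_map X Y f \<longleftrightarrow> continuous_map X Y f \<and>
     (\<exists>Z \<subseteq> topspace X. f ` Z = topspace Y \<and>
        (\<forall>K. precompact_in Y K \<longrightarrow> precompact_in X (Z \<inter> f -` K)))"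

definition radon_prob_measures :: "'a topology \<Rightarrow> 'a measure set" where
  "radon_prob_measures X =
     {\<mu>. sets \<mu> = sets (borel_of X) \<and> prob_space \<mu> \<and>
        (\<forall>\<epsilon>>0. \<forall>B\<in>sets \<mu>. \<exists>K\<subseteq>B. compactin X K \<and> measure \<mu> (B - K) < \<epsilon>)}"

definition uniformly_tight :: "'a topology \<Rightarrow> 'a measure set \<Rightarrow> bool" where
  "uniformly_tight X M \<longleftrightarrow> M \<subseteq> radon_prob_measures X \<and>
     (\<forall>\<epsilon>>0. \<exists>K. compactin X K \<and> (\<forall>\<mu>\<in>M. measure \<mu> (topspace X - K) < \<epsilon>))"

text \<open>Lebesgue measure on the Borel sets of the unit interval; functions measurable with respect
  to it are exactly the Borel functions.\<close>

abbreviation unit_lborel :: "real measure" where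
  "unit_lborel \<equiv> restrict_space lborel {0..1}"

definition weak_skorohod :: "'a topology \<Rightarrow> bool" where
  "weak_skorohod X \<longleftrightarrow>
     (\<exists>\<xi> :: 'a measure \<Rightarrow> real \<Rightarrow> 'a.
        (\<forall>\<mu>\<in>radon_prob_measures X.
           \<xi> \<mu> \<in> unit_lborel \<rightarrow>\<^sub>M borel_of X \<and> distr unit_lborel (borel_of X) (\<xi> \<mu>) = \<mu>) \<and>
        (\<forall>\<mu> :: nat \<Rightarrow> 'a measure. uniformly_tight X (range \<mu>) \<longrightarrow>
           (\<exists>r :: nat \<Rightarrow> nat. strict_mono r \<and>
              (AE t in unit_lborel. \<exists>l. limitin X (\<lambda>n. \<xi> (\<mu> (r n)) t) l sequentially))))"

end

theory Submission
  imports Defs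
begin

text \<open>
  The forward implication is witnessed by the identity map of \<open>Y\<close>. For the converse, let \<open>Z\<close> witness
  that \<open>f\<close> is subproper and put \<open>C K = closure (Z \<inter> f -` K)\<close>; this set is compact in \<open>X\<close> for every
  compact \<open>K\<close> in \<open>Y\<close>, and \<open>f\<close> maps it into \<open>K\<close>. The heart of the proof is a lifting of measures
  (\<open>radon_lift\<close>): each Radon probability \<open>\<mu>\<close> on \<open>Y\<close> admits a Radon probability \<open>\<nu>\<close> on \<open>X\<close> with
  \<open>\<mu> K \<le> \<nu> (C K)\<close> for all compact \<open>K\<close> simultaneously. This one family of inequalities does two jobs.
  It forces the image of \<open>\<nu>\<close> under \<open>f\<close> to dominate \<open>\<mu>\<close> on compact sets, hence on Borel sets by the
  Radon property, hence to equal \<open>\<mu>\<close>, because both have total mass one. It also shows that the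
  lifts of a uniformly tight family are uniformly tight: where \<open>K\<close> carries almost all the mass of
  every \<open>\<mu>\<close>, the compact set \<open>C K\<close> carries almost all the mass of every lift. Therefore
  \<open>\<mu> \<mapsto> f \<circ> \<xi> (lift \<mu>)\<close> is a Skorohod parametrization for \<open>Y\<close> whenever \<open>\<xi>\<close> is one for \<open>X\<close>: almost sure
  limits in \<open>X\<close> are carried to limits in \<open>Y\<close> by continuity.

  The obstacle to lifting is that a section \<open>s\<close> of \<open>f\<close> with values in \<open>Z\<close> need not be measurable in any sense.
  Countable additivity is therefore given up at first: \<open>finitely_additive_image\<close> produces a finitely
  additive probability \<open>m\<close> on all subsets of \<open>X\<close> with \<open>\<mu> A \<le> m (s ` A)\<close>. Then \<open>m\<close> is regularized: passing
  to the infimum over open neighbourhoods gives a content on compact sets, whose associated outer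
  measure is countably additive on Borel sets and dominates \<open>m\<close> on compact sets. The estimate
  \<open>m (C K) \<ge> \<mu> K\<close> makes \<open>m\<close> tight, so no mass is lost and the regularization is a Radon probability.
  Working with compact sets rather than with integrals of continuous functions is what allows \<open>X\<close> to
  be an arbitrary Hausdorff space, where continuous functions may be scarce.
\<close>

section \<open>Borel sets of a topology\<close>

lemma space_borel_of: "space (borel_of X) = topspace X"
  unfolding borel_of_def by (rule space_measure_of) (auto dest: openin_subset)

lemma sets_borel_of: "sets (borel_of X) = sigma_sets (topspace X) {U. openin X U}"
  unfolding borel_of_def by (rule sets_measure_of) (auto dest: openin_subset)

lemma openin_imp_borel: "openin X U \<Longrightarrow> U \<in> sets (borel_of X)"
  by (simp add: sets_borel_of sigma_sets.Basic)

lemma closedin_imp_borel: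
  assumes "closedin X C"
  shows "C \<in> sets (borel_of X)"
proof -
  have "topspace X - (topspace X - C) = C"
    using closedin_subset[OF assms] by blast
  then show ?thesis
    using sets.compl_sets[OF openin_imp_borel[of X "topspace X - C"]] assms
    by (simp add: space_borel_of closedin_def)
qed

lemma compactin_imp_borel: "Hausdorff_space X \<Longrightarrow> compactin X C \<Longrightarrow> C \<in> sets (borel_of X)"
  by (simp add: closedin_imp_borel compactin_imp_closedin)

lemma continuous_map_borel:
  assumes "continuous_map X Y f"
  shows "f \<in> borel_of X \<rightarrow>\<^sub>M borel_of Y"
  unfolding borel_of_def[of Y]
proof (rule measurable_measure_of)
  show "{U. openin Y U} \<subseteq> Pow (topspace Y)"
    by (auto dest: openin_subset)
  show "f \<in> space (borel_of X) \<rightarrow> topspace Y"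
    using assms by (auto simp: space_borel_of continuous_map_def)
  fix U assume "U \<in> {U. openin Y U}"
  then have "openin X {x \<in> topspace X. f x \<in> U}"
    using assms by (simp add: continuous_map_def)
  moreover have "f -` U \<inter> space (borel_of X) = {x \<in> topspace X. f x \<in> U}"
    by (auto simp: space_borel_of)
  ultimately show "f -` U \<inter> space (borel_of X) \<in> sets (borel_of X)"
    by (simp add: openin_imp_borel)
qed

lemma radon_prob_measuresD:
  assumes "\<mu> \<in> radon_prob_measures X"
  shows "sets \<mu> = sets (borel_of X)" "space \<mu> = topspace X" "prob_space \<mu>"
    and "\<And>e B. e > 0 \<Longrightarrow> B \<in> sets \<mu> \<Longrightarrow> \<exists>K\<subseteq>B. compactin X K \<and> measure \<mu> (B - K) < e"
  using assms sets_eq_imp_space_eq[of \<mu> "borel_of X"]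
  by (auto simp: radon_prob_measures_def space_borel_of)

section \<open>Radon measures from finitely additive charges\<close>

text \<open>
  Lets an infimum be estimated under a sum without case distinctions on infinite values or on
  empty index sets.
\<close>
lemma le_add_INF_ennreal:
  fixes z c :: ennreal
  assumes "\<And>i. i \<in> I \<Longrightarrow> z \<le> c + f i"
  shows "z \<le> c + (INF i\<in>I. f i)"
proof (cases "c = top")
  case False
  have "z - c \<le> (INF i\<in>I. f i)"
    using assms False by (intro INF_greatest) (simp add: ennreal_minus_le_iff)
  then show ?thesis
    using False by (simp add: ennreal_minus_le_iff)
qed simp

text \<open>
  The charge \<open>m\<close> is finitely additive on all subsets, including those that are neither Borel nor
  contained in the carrier of \<open>X\<close>.
\<close>
locale Hausdorff_charge =
  fixes X :: "'a topology" and m :: "'a set \<Rightarrow> ennreal"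
  assumes Hausdorff: "Hausdorff_space X"
    and additive: "\<And>A B. A \<inter> B = {} \<Longrightarrow> m (A \<union> B) = m A + m B"
    and total: "m UNIV = 1"
begin

text \<open>
  Meaningful for compact arguments only, where it is a content: monotone, subadditive, and additive
  on disjoint sets. The next two definitions repeat the passage from a content to an outer measure
  known from Haar measure, without local compactness.
\<close>
definition compact_mass :: "'a set \<Rightarrow> ennreal" where
  "compact_mass C = (INF U\<in>{U. openin X U \<and> C \<subseteq> U}. m U)"

definition open_mass :: "'a set \<Rightarrow> ennreal" where
  "open_mass U = (SUP C\<in>{C. compactin X C \<and> C \<subseteq> U}. compact_mass C)"

definition outer_mass :: "'a set \<Rightarrow> ennreal" where
  "outer_mass A = (INF U\<in>{U. openin X U \<and> A \<subseteq> U}. open_mass U)"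

lemma m_mono: "A \<subseteq> B \<Longrightarrow> m A \<le> m B"
  using additive[of A "B - A"] by (simp add: Un_absorb1)

lemma m_le_1: "m A \<le> 1"
  using m_mono[of A UNIV] total by simp

lemma m_empty: "m {} = 0"
proof -
  have "m {} \<noteq> top"
    using m_le_1[of "{}"] by (auto simp: top_unique)
  moreover have "m {} = m {} + m {}"
    using additive[of "{}" "{}"] by simp
  ultimately show ?thesis
    using ennreal_add_left_cancel[of "m {}" "m {}" 0] by auto
qed

lemma m_subadditive: "m (A \<union> B) \<le> m A + m B"
proof -
  have "m (A \<union> B) = m A + m (B - A)"
    using additive[of A "B - A"] by simp
  also have "\<dots> \<le> m A + m B"
    by (intro add_left_mono m_mono) blast
  finally show ?thesis .
qed

lemma compact_mass_le: "openin X U \<Longrightarrow> C \<subseteq> U \<Longrightarrow> compact_mass C \<le> m U"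
  unfolding compact_mass_def by (rule INF_lower) simp

lemma le_compact_mass: "m C \<le> compact_mass C"
  unfolding compact_mass_def by (rule INF_greatest) (simp add: m_mono)

lemma compact_mass_subadditive: "compact_mass (C \<union> D) \<le> compact_mass C + compact_mass D"
proof -
  have "compact_mass (C \<union> D) \<le> m V + m U"
    if "openin X U" "C \<subseteq> U" "openin X V" "D \<subseteq> V" for U V
  proof -
    have "compact_mass (C \<union> D) \<le> m (V \<union> U)"
      using that by (intro compact_mass_le) auto
    then show ?thesis
      using m_subadditive order_trans by blast
  qed
  then have "compact_mass (C \<union> D) \<le> m V + compact_mass C" if "openin X V" "D \<subseteq> V" for V
    unfolding compact_mass_def[of C] using that by (intro le_add_INF_ennreal) auto
  then show ?thesis
    unfolding compact_mass_def[of D]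
    by (intro le_add_INF_ennreal) (auto simp: add.commute)
qed

text \<open>
  Disjoint compact sets have disjoint open neighbourhoods; the charge may cut any neighbourhood of the
  union along these.
\<close>
lemma compact_mass_superadditive:
  assumes "compactin X C" "compactin X D" "C \<inter> D = {}"
  shows "compact_mass C + compact_mass D \<le> compact_mass (C \<union> D)"
  unfolding compact_mass_def[of "C \<union> D"]
proof (rule INF_greatest)
  fix W assume W: "W \<in> {U. openin X U \<and> C \<union> D \<subseteq> U}"
  obtain U V where UV: "openin X U" "openin X V" "C \<subseteq> U" "D \<subseteq> V" "disjnt U V"
    using Hausdorff_space_compact_separation[OF Hausdorff assms(1,2)] assms(3)
    by (auto simp: disjnt_def)
  have "compact_mass C + compact_mass D \<le> m (U \<inter> W) + m (V \<inter> W)"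
    using UV W by (intro add_mono compact_mass_le) auto
  also have "\<dots> = m (U \<inter> W \<union> V \<inter> W)"
    using UV(5) by (subst additive) (auto simp: disjnt_def)
  also have "\<dots> \<le> m W"
    by (rule m_mono) auto
  finally show "compact_mass C + compact_mass D \<le> m W" .
qed

lemma compact_mass_le_open_mass: "compactin X C \<Longrightarrow> C \<subseteq> U \<Longrightarrow> compact_mass C \<le> open_mass U"
  unfolding open_mass_def by (rule SUP_upper) simp

lemma open_mass_mono: "U \<subseteq> V \<Longrightarrow> open_mass U \<le> open_mass V"
  unfolding open_mass_def by (rule SUP_subset_mono) auto

lemma open_mass_le: "openin X U \<Longrightarrow> open_mass U \<le> m U"
  unfolding open_mass_def by (rule SUP_least) (simp add: compact_mass_le)

lemma open_mass_empty: "open_mass {} = 0"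
  using open_mass_le[of "{}"] m_empty by simp

lemma compactin_Diff_openin:
  assumes "compactin X C" "openin X U"
  shows "compactin X (C - U)"
proof -
  have "C - U = C \<inter> (topspace X - U)"
    using compactin_subset_topspace[OF assms(1)] by auto
  then show ?thesis
    using compact_Int_closedin[OF assms(1) closedin_diff[OF closedin_topspace assms(2)]] by simp
qed

text \<open>
  A compact subset of \<open>U \<union> V\<close> splits into a compact subset of \<open>U\<close> and one of \<open>V\<close>: the disjoint compact
  sets \<open>C - U\<close> and \<open>C - V\<close> are separated by open sets \<open>A\<close> and \<open>B\<close>, and the pieces are \<open>C - A\<close> and \<open>C - B\<close>.
\<close>
lemma open_mass_Un:
  assumes U: "openin X U" and V: "openin X V"
  shows "open_mass (U \<union> V) \<le> open_mass U + open_mass V"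
  unfolding open_mass_def[of "U \<union> V"]
proof (rule SUP_least)
  fix C assume "C \<in> {C. compactin X C \<and> C \<subseteq> U \<union> V}"
  then have C: "compactin X C" "C \<subseteq> U \<union> V" by auto
  obtain A B where AB: "openin X A" "openin X B" "C - U \<subseteq> A" "C - V \<subseteq> B" "disjnt A B"
    using Hausdorff_space_compact_separation[OF Hausdorff compactin_Diff_openin[OF C(1) U]
        compactin_Diff_openin[OF C(1) V]] C(2)
    by (auto simp: disjnt_def)
  have "C = (C - A) \<union> (C - B)"
    using AB(5) by (auto simp: disjnt_def)
  then have "compact_mass C \<le> compact_mass (C - A) + compact_mass (C - B)"
    by (metis compact_mass_subadditive)
  also have "\<dots> \<le> open_mass U + open_mass V"
    using AB C by (intro add_mono compact_mass_le_open_mass compactin_Diff_openin) auto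
  finally show "compact_mass C \<le> open_mass U + open_mass V" .
qed

text \<open>
  This is where countable additivity comes from, although the charge has none: a compact set inside
  the union is already covered by finitely many of the open sets.
\<close>
lemma open_mass_countably_subadditive:
  assumes U: "\<And>n::nat. openin X (U n)"
  shows "open_mass (\<Union>n. U n) \<le> (\<Sum>n. open_mass (U n))"
  unfolding open_mass_def[of "\<Union>n. U n"]
proof (rule SUP_least)
  fix C assume "C \<in> {C. compactin X C \<and> C \<subseteq> (\<Union>n. U n)}"
  then have C: "compactin X C" "C \<subseteq> (\<Union>n. U n)" by auto
  obtain F where F: "finite F" "F \<subseteq> range U" "C \<subseteq> \<Union>F"
    using compactinD[OF C(1), of "range U"] C(2) U by auto
  obtain I where I: "finite I" "F = U ` I"
    using finite_subset_image[OF F(1,2)] by auto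
  have fin: "open_mass (\<Union>n\<in>I. U n) \<le> (\<Sum>n\<in>I. open_mass (U n))"
    using I(1)
  proof (induction I)
    case empty
    then show ?case by (simp add: open_mass_empty)
  next
    case (insert n I)
    have "open_mass (U n \<union> (\<Union>n\<in>I. U n)) \<le> open_mass (U n) + open_mass (\<Union>n\<in>I. U n)"
      using U by (intro open_mass_Un) auto
    also have "\<dots> \<le> open_mass (U n) + (\<Sum>n\<in>I. open_mass (U n))"
      using insert.IH by (rule add_left_mono)
    finally show ?case
      using insert.hyps by simp
  qed
  have "compact_mass C \<le> open_mass (\<Union>n\<in>I. U n)"
    using F I C by (intro compact_mass_le_open_mass) auto
  also note fin
  also have "(\<Sum>n\<in>I. open_mass (U n)) \<le> (\<Sum>n. open_mass (U n))"
    using I(1) by (intro sum_le_suminf) auto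
  finally show "compact_mass C \<le> (\<Sum>n. open_mass (U n))" .
qed

lemma outer_le: "openin X U \<Longrightarrow> A \<subseteq> U \<Longrightarrow> outer_mass A \<le> open_mass U"
  unfolding outer_mass_def by (rule INF_lower) simp

lemma outer_open: "openin X U \<Longrightarrow> outer_mass U = open_mass U"
  by (rule antisym[OF outer_le]) (auto simp: outer_mass_def intro!: INF_greatest open_mass_mono)

lemma outer_mono: "A \<subseteq> B \<Longrightarrow> outer_mass A \<le> outer_mass B"
  unfolding outer_mass_def by (rule INF_superset_mono) auto

lemma le_outer_compact: "compactin X C \<Longrightarrow> m C \<le> outer_mass C"
  unfolding outer_mass_def
  by (intro INF_greatest order_trans[OF le_compact_mass]) (simp add: compact_mass_le_open_mass)

lemma outer_le_1: "A \<subseteq> topspace X \<Longrightarrow> outer_mass A \<le> 1"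
  by (rule order_trans[OF outer_le order_trans[OF open_mass_le m_le_1]]) auto

text \<open>
  The outer mass is finite, so adding a positive error makes the defining infimum strictly smaller.
\<close>
lemma outer_approx:
  fixes A :: "'a set"
  assumes "A \<subseteq> topspace X" "e > (0::ennreal)"
  obtains U where "openin X U" "A \<subseteq> U" "open_mass U \<le> outer_mass A + e"
proof -
  have "outer_mass A \<noteq> top"
    using outer_le_1[OF assms(1)] by (auto simp: top_unique)
  then have "outer_mass A < outer_mass A + e"
    using assms(2) ennreal_add_left_cancel_less[of "outer_mass A" 0 e] by (simp add: less_top)
  then have "(INF U\<in>{U. openin X U \<and> A \<subseteq> U}. open_mass U) < outer_mass A + e"
    by (simp only: outer_mass_def[symmetric])
  then show thesis
    using that by (auto simp: INF_less_iff intro: less_imp_le)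
qed

lemma outer_countably_subadditive: "countably_subadditive (Pow (topspace X)) outer_mass"
  unfolding countably_subadditive_def
proof (intro allI impI)
  fix A :: "nat \<Rightarrow> 'a set"
  assume A: "range A \<subseteq> Pow (topspace X)"
  show "outer_mass (\<Union>i. A i) \<le> (\<Sum>i. outer_mass (A i))"
  proof (rule ennreal_le_epsilon)
    fix e :: real assume e: "0 < e"
    have "\<exists>U. openin X U \<and> A n \<subseteq> U \<and> open_mass U \<le> outer_mass (A n) + ennreal (e * (1/2)^Suc n)" for n
    proof -
      have "A n \<subseteq> topspace X" "0 < ennreal (e * (1/2)^Suc n)"
        using A e by auto
      then show ?thesis
        using outer_approx by metis
    qed
    then obtain U where U: "\<And>n. openin X (U n)" "\<And>n. A n \<subseteq> U n"
        "\<And>n. open_mass (U n) \<le> outer_mass (A n) + ennreal (e * (1/2)^Suc n)"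
      by metis
    have "outer_mass (\<Union>i. A i) \<le> open_mass (\<Union>i. U i)"
      using U by (intro outer_le) blast+
    also have "\<dots> \<le> (\<Sum>i. open_mass (U i))"
      using U by (intro open_mass_countably_subadditive)
    also have "\<dots> \<le> (\<Sum>i. outer_mass (A i) + ennreal (e * (1/2)^Suc i))"
      using U by (intro suminf_le) auto
    also have "\<dots> = (\<Sum>i. outer_mass (A i)) + (\<Sum>i. ennreal (e * (1/2)^Suc i))"
      by (intro suminf_add[symmetric]) auto
    also have "(\<Sum>i. ennreal (e * (1/2)^Suc i)) = ennreal e"
      using e sums_mult[OF power_half_series, of e] by (intro suminf_ennreal_eq) auto
    finally show "outer_mass (\<Union>i. A i) \<le> (\<Sum>i. outer_mass (A i)) + ennreal e" .
  qed
qed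

lemma outer_measure_space_outer: "outer_measure_space (Pow (topspace X)) outer_mass"
  unfolding outer_measure_space_def
  using outer_countably_subadditive outer_open[of "{}"] open_mass_empty outer_mono
  by (simp add: positive_def increasing_def)

text \<open>
  Caratheodory's criterion for an open set \<open>U\<close>. Given open \<open>W\<close> containing \<open>A\<close>, take a compact set \<open>C\<close> in \<open>W \<inter> U\<close> and
  a compact set \<open>D\<close> in the open set \<open>W - C\<close>. The masses of \<open>C\<close> and \<open>D\<close> add up to at most that of \<open>W\<close>, while
  \<open>W - C\<close> still covers \<open>A - U\<close>; take the supremum over \<open>D\<close> and then over \<open>C\<close>.
\<close>
lemma openin_lambda_system:
  assumes U: "openin X U"
  shows "U \<in> lambda_system (topspace X) (Pow (topspace X)) outer_mass"
proof -
  interpret algebra "topspace X" "Pow (topspace X)"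
    by (rule algebra_Pow)
  have ge: "outer_mass (A \<inter> U) + outer_mass (A - U) \<le> outer_mass A" if A: "A \<subseteq> topspace X" for A
    unfolding outer_mass_def[of A]
  proof (rule INF_greatest)
    fix W assume "W \<in> {W. openin X W \<and> A \<subseteq> W}"
    then have W: "openin X W" "A \<subseteq> W" by auto
    have step: "outer_mass (A - U) + compact_mass C \<le> open_mass W" if C: "compactin X C" "C \<subseteq> W \<inter> U" for C
    proof -
      have op: "openin X (W - C)"
        using W(1) C(1) Hausdorff by (simp add: compactin_imp_closedin openin_diff)
      have ne: "{D. compactin X D \<and> D \<subseteq> W - C} \<noteq> {}"
        using compactin_empty by blast
      have "outer_mass (A - U) + compact_mass C \<le> open_mass (W - C) + compact_mass C"
        using op W C by (intro add_right_mono outer_le) auto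
      also have "\<dots> = (SUP D\<in>{D. compactin X D \<and> D \<subseteq> W - C}. compact_mass D + compact_mass C)"
        unfolding open_mass_def by (rule ennreal_SUP_add_left[OF ne, symmetric])
      also have "\<dots> \<le> open_mass W"
      proof (rule SUP_least)
        fix D assume "D \<in> {D. compactin X D \<and> D \<subseteq> W - C}"
        then have "compact_mass D + compact_mass C \<le> compact_mass (D \<union> C)" "compact_mass (D \<union> C) \<le> open_mass W"
          using C by (auto intro!: compact_mass_superadditive compact_mass_le_open_mass compactin_Un)
        then show "compact_mass D + compact_mass C \<le> open_mass W"
          by (rule order_trans)
      qed
      finally show ?thesis .
    qed
    have ne: "{C. compactin X C \<and> C \<subseteq> W \<inter> U} \<noteq> {}"
      using compactin_empty by blast
    have "outer_mass (A \<inter> U) + outer_mass (A - U) \<le> outer_mass (A - U) + open_mass (W \<inter> U)"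
      using W U by (subst add.commute) (intro add_left_mono outer_le, auto)
    also have "\<dots> = (SUP C\<in>{C. compactin X C \<and> C \<subseteq> W \<inter> U}. outer_mass (A - U) + compact_mass C)"
      unfolding open_mass_def by (rule ennreal_SUP_add_right[OF ne])
    also have "\<dots> \<le> open_mass W"
      using step by (intro SUP_least) auto
    finally show "outer_mass (A \<inter> U) + outer_mass (A - U) \<le> open_mass W" .
  qed
  have le: "outer_mass A \<le> outer_mass (A \<inter> U) + outer_mass (A - U)" if A: "A \<subseteq> topspace X" for A
  proof -
    have "subadditive (Pow (topspace X)) outer_mass"
      using outer_measure_space_outer
      by (intro countably_subadditive_subadditive) (auto simp: outer_measure_space_def)
    then have "outer_mass ((A \<inter> U) \<union> (A - U)) \<le> outer_mass (A \<inter> U) + outer_mass (A - U)"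
      using A by (intro subadditiveD) auto
    then show ?thesis
      by (simp add: Int_Diff_Un)
  qed
  show ?thesis
    using ge le openin_subset[OF U] by (auto simp: lambda_system_eq intro!: antisym)
qed

definition regularization :: "'a measure" where
  "regularization = measure_of (topspace X) (sets (borel_of X)) outer_mass"

lemma sets_regularization: "sets regularization = sets (borel_of X)"
  unfolding regularization_def space_borel_of[symmetric] by simp

lemma emeasure_regularization:
  assumes "B \<in> sets (borel_of X)"
  shows "emeasure regularization B = outer_mass B"
proof -
  interpret sigma_algebra "topspace X" "Pow (topspace X)"
    by (rule sigma_algebra_Pow)
  let ?L = "lambda_system (topspace X) (Pow (topspace X)) outer_mass"
  have L: "measure_space (topspace X) ?L outer_mass"
    by (rule caratheodory_lemma[OF outer_measure_space_outer])
  then have "sigma_sets (topspace X) {U. openin X U} \<subseteq> ?L"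
    using openin_lambda_system
    by (intro sigma_algebra.sigma_sets_subset) (auto simp: measure_space_def)
  then have "measure_space (topspace X) (sigma_sets (topspace X) {U. openin X U}) outer_mass"
    using L by (intro measure_down[OF L] sigma_algebra_sigma_sets) (auto dest: openin_subset)
  then show ?thesis
    using assms unfolding regularization_def sets_borel_of measure_space_def
    by (intro emeasure_measure_of_sigma) simp_all
qed

lemma space_regularization: "space regularization = topspace X"
  using sets_eq_imp_space_eq[OF sets_regularization] by (simp add: space_borel_of)

lemma regularization_compact:
  "compactin X C \<Longrightarrow> m C \<le> emeasure regularization C"
  by (simp add: emeasure_regularization compactin_imp_borel[OF Hausdorff] le_outer_compact)

text \<open>
  Regularization can lose mass only by its escaping from compact sets, which tightness prevents.
  Inner regularity follows from tightness and outer regularity: inside a compact set \<open>C\<close> of almost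
  full measure, remove an open set \<open>U\<close> that covers the complement of \<open>B\<close> efficiently.
\<close>
lemma regularization_radon:
  assumes tight: "\<And>e. e > 0 \<Longrightarrow> \<exists>K. compactin X K \<and> ennreal (1 - e) \<le> m K"
  shows "regularization \<in> radon_prob_measures X"
proof -
  let ?\<nu> = regularization
  have comp: "\<exists>K. compactin X K \<and> ennreal (1 - e) \<le> emeasure ?\<nu> K" if "e > 0" for e
    using tight[OF that] regularization_compact by (meson order_trans)
  have le1: "emeasure ?\<nu> (topspace X) \<le> 1"
    using outer_le_1 by (simp add: emeasure_regularization openin_imp_borel)
  have ge1: "1 \<le> emeasure ?\<nu> (topspace X)"
  proof (rule ennreal_le_epsilon)
    fix e :: real assume "0 < e"
    then obtain K where K: "compactin X K" "ennreal (1 - e) \<le> emeasure ?\<nu> K"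
      using comp by blast
    have "1 \<le> ennreal (1 - e) + ennreal e"
      using \<open>0 < e\<close> by (cases "e \<le> 1") (auto simp: ennreal_plus[symmetric] ennreal_neg simp del: ennreal_plus)
    also have "ennreal (1 - e) \<le> emeasure ?\<nu> (topspace X)"
      using K compactin_subset_topspace[OF K(1)]
      by (intro order_trans[OF K(2)] emeasure_mono)
        (auto simp: sets_regularization openin_imp_borel)
    finally show "1 \<le> emeasure ?\<nu> (topspace X) + ennreal e"
      by (simp add: add_right_mono)
  qed
  have prob: "prob_space ?\<nu>"
    using le1 ge1 by (intro prob_spaceI) (simp add: space_regularization)
  interpret prob_space ?\<nu> by (rule prob)
  have "\<exists>K\<subseteq>B. compactin X K \<and> measure ?\<nu> (B - K) < e"
    if e: "e > 0" and B: "B \<in> sets ?\<nu>" for e B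
  proof -
    have BX: "B \<subseteq> topspace X"
      using sets.sets_into_space[OF B] by (simp add: space_regularization)
    obtain C where C: "compactin X C" "ennreal (1 - e/4) \<le> emeasure ?\<nu> C"
      using comp[of "e/4"] e by auto
    have Cs[measurable]: "C \<in> sets ?\<nu>"
      using C(1) by (simp add: sets_regularization compactin_imp_borel[OF Hausdorff])
    have mC: "1 - e/4 \<le> measure ?\<nu> C"
      using C(2) by (simp add: emeasure_eq_measure ennreal_le_iff)
    have cB: "topspace X - B \<in> sets ?\<nu>"
      using sets.compl_sets[OF B] by (simp add: space_regularization)
    obtain U where U: "openin X U" "topspace X - B \<subseteq> U"
        "open_mass U \<le> outer_mass (topspace X - B) + ennreal (e/2)"
      using outer_approx[of "topspace X - B" "ennreal (e/2)"] e by auto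
    have Us[measurable]: "U \<in> sets ?\<nu>"
      using U(1) by (simp add: sets_regularization openin_imp_borel)
    have "emeasure ?\<nu> U \<le> emeasure ?\<nu> (topspace X - B) + ennreal (e/2)"
      using U(3) Us cB by (simp add: emeasure_regularization outer_open[OF U(1)] sets_regularization)
    then have mU: "measure ?\<nu> U \<le> measure ?\<nu> (topspace X - B) + e/2"
      using e by (simp add: emeasure_eq_measure ennreal_plus[symmetric] del: ennreal_plus)
    have "measure ?\<nu> (U \<inter> B) = measure ?\<nu> (U - (topspace X - B))"
      using BX openin_subset[OF U(1)] by (intro arg_cong[where f="measure ?\<nu>"]) auto
    also have "\<dots> = measure ?\<nu> U - measure ?\<nu> (topspace X - B)"
      using U(2) Us cB by (intro finite_measure_Diff) auto
    finally have mUB: "measure ?\<nu> (U \<inter> B) \<le> e/2"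
      using mU by simp
    have "measure ?\<nu> (B - (C - U)) \<le> measure ?\<nu> ((space ?\<nu> - C) \<union> (U \<inter> B))"
    proof (rule finite_measure_mono)
      show "B - (C - U) \<subseteq> (space ?\<nu> - C) \<union> (U \<inter> B)"
        using BX by (auto simp: space_regularization)
      show "(space ?\<nu> - C) \<union> (U \<inter> B) \<in> sets ?\<nu>"
        using B Cs Us by (intro sets.Un sets.Int sets.compl_sets)
    qed
    also have "\<dots> \<le> measure ?\<nu> (space ?\<nu> - C) + measure ?\<nu> (U \<inter> B)"
      using B by (intro measure_Un_le) auto
    also have "\<dots> < e"
      using mUB mC e by (simp add: prob_compl)
    finally have "measure ?\<nu> (B - (C - U)) < e" .
    moreover have "C - U \<subseteq> B"
      using U(2) compactin_subset_topspace[OF C(1)] by auto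
    ultimately show ?thesis
      using compactin_Diff_openin[OF C(1) U(1)] by blast
  qed
  then show ?thesis
    using prob by (simp add: radon_prob_measures_def sets_regularization)
qed

end

section \<open>Finitely additive images under arbitrary functions\<close>

definition prob_charge :: "('a set \<Rightarrow> real) \<Rightarrow> bool" where
  "prob_charge m \<longleftrightarrow> (\<forall>A. 0 \<le> m A \<and> m A \<le> 1) \<and> m UNIV = 1 \<and>
     (\<forall>A B. A \<inter> B = {} \<longrightarrow> m (A \<union> B) = m A + m B)"

lemma prob_charge_mono:
  assumes "prob_charge m" "A \<subseteq> B"
  shows "m A \<le> m B"
proof -
  have "m (A \<union> (B - A)) = m A + m (B - A)" "0 \<le> m (B - A)"
    using assms(1) unfolding prob_charge_def by blast+
  then show ?thesis
    using assms(2) by (simp add: Un_absorb1)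
qed

lemma prob_charge_measure:
  assumes "prob_space M" "sets M = UNIV"
  shows "prob_charge (measure M)"
proof -
  interpret prob_space M by fact
  have "space M = UNIV"
    using assms(2) sets.top sets.sets_into_space by auto
  then show ?thesis
    using assms(2) prob_space by (auto simp: prob_charge_def intro: finite_measure_Union)
qed

text \<open>
  In the topology of pointwise convergence the charges form a closed subset of a power of the unit
  interval, since finite additivity constrains finitely many coordinates at a time. This is the
  point where countably additive measures would fail.
\<close>
lemma compact_prob_charges: "compact {m :: 'a set \<Rightarrow> real. prob_charge m}"
proof -
  have "compactin (product_topology (\<lambda>i. euclidean) UNIV) (PiE (UNIV :: 'a set set) (\<lambda>_. {0..1::real}))"
    by (simp add: compactin_PiE)
  then have cube: "compact (PiE (UNIV :: 'a set set) (\<lambda>_. {0..1::real}))"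
    by (simp add: euclidean_product_topology)
  have cont: "continuous_on UNIV (\<lambda>m :: 'a set \<Rightarrow> real. m A)" for A
    by (rule continuous_on_product_coordinates)
  have "closed {m :: 'a set \<Rightarrow> real. prob_charge m}"
    unfolding prob_charge_def
    by (intro closed_Collect_conj closed_Collect_all closed_Collect_imp closed_Collect_le
        closed_Collect_eq continuous_on_add continuous_on_const cont open_Collect_const)
  then have "compact (PiE UNIV (\<lambda>_. {0..1}) \<inter> {m :: 'a set \<Rightarrow> real. prob_charge m})"
    using cube by (intro compact_Int_closed)
  moreover have "PiE UNIV (\<lambda>_. {0..1}) \<inter> {m :: 'a set \<Rightarrow> real. prob_charge m} = {m. prob_charge m}"
    by (auto simp: prob_charge_def)
  ultimately show ?thesis
    by simp
qed

text \<open>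
  Finitely many sets divide the space into finitely many cells. Replacing each point by a chosen
  representative of its cell gives a measurable function with finite range, so it can be followed by
  any function \<open>s\<close> and still has an honest image measure.
\<close>
lemma finitely_additive_image_finite:
  fixes s :: "'b \<Rightarrow> 'a"
  assumes M: "prob_space M" and F: "finite F" "F \<subseteq> sets M"
  shows "\<exists>m. prob_charge m \<and> (\<forall>A\<in>F. measure M A \<le> m (s ` A))"
proof -
  interpret prob_space M by fact
  \<comment> \<open>The cell of a point is encoded by the members of \<open>F\<close> that contain it; \<open>r\<close> picks representatives.\<close>
  define a where "a y = {A\<in>F. y \<in> A}" for y
  define r where "r S = (SOME y. y \<in> space M \<and> a y = S)" for S
  have r: "r (a y) \<in> space M \<and> a (r (a y)) = a y" if "y \<in> space M" for y
    using someI[of "\<lambda>z. z \<in> space M \<and> a z = a y" y] that by (simp add: r_def)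
  have a: "a \<in> M \<rightarrow>\<^sub>M count_space (Pow F)"
    unfolding measurable_count_space_eq2[OF finite_Pow_iff[THEN iffD2, OF F(1)]]
  proof (intro conjI ballI)
    show "a \<in> space M \<rightarrow> Pow F"
      by (auto simp: a_def)
    fix S assume "S \<in> Pow F"
    then have "a y = S \<longleftrightarrow> (\<forall>A\<in>F. y \<in> A \<longleftrightarrow> A \<in> S)" for y
      unfolding a_def by blast
    then have "a -` {S} \<inter> space M = {y \<in> space M. \<forall>A\<in>F. y \<in> A \<longleftrightarrow> A \<in> S}"
      by (simp add: vimage_def Int_def conj_commute)
    also have "\<dots> \<in> sets M"
    proof (rule sets.sets_Collect_finite_All[OF _ F(1)])
      fix A assume "A \<in> F"
      then have A: "A \<in> sets M" "A \<subseteq> space M"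
        using F(2) sets.sets_into_space by blast+
      then have "{y \<in> space M. y \<in> A \<longleftrightarrow> A \<in> S} = (if A \<in> S then A else space M - A)"
        by auto
      with A(1) show "{y \<in> space M. y \<in> A \<longleftrightarrow> A \<in> S} \<in> sets M"
        by simp
    qed
    finally show "a -` {S} \<inter> space M \<in> sets M" .
  qed
  have meas: "(\<lambda>y. s (r (a y))) \<in> M \<rightarrow>\<^sub>M count_space UNIV"
    by (rule measurable_compose[OF a]) simp
  let ?N = "distr M (count_space UNIV) (\<lambda>y. s (r (a y)))"
  have "prob_charge (measure ?N)"
    using meas by (intro prob_charge_measure prob_space_distr) auto
  moreover have "measure M A \<le> measure ?N (s ` A)" if A: "A \<in> F" for A
  proof -
    have "r (a y) \<in> A" if "y \<in> A" for y
    proof -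
      have "y \<in> space M"
        using that A F(2) sets.sets_into_space by blast
      then have "A \<in> a (r (a y))"
        using r that A by (simp add: a_def)
      then show ?thesis
        by (simp add: a_def)
    qed
    then have "A \<subseteq> (\<lambda>y. s (r (a y))) -` (s ` A) \<inter> space M"
      using A F(2) sets.sets_into_space by blast
    then show ?thesis
      using meas by (simp add: measure_distr measurable_sets finite_measure_mono)
  qed
  ultimately show ?thesis
    by blast
qed

text \<open>
  Each inequality is a closed condition on the charge and any finitely many can be met, so compactness
  meets them all. As charges are monotone, the bound passes from \<open>s ` A\<close> to
  every set that contains it.
\<close>
lemma finitely_additive_image:
  fixes s :: "'b \<Rightarrow> 'a"
  assumes "prob_space M"
  obtains m where "prob_charge m" "\<And>A. A \<in> sets M \<Longrightarrow> measure M A \<le> m (s ` A)"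
proof -
  have "{m :: 'a set \<Rightarrow> real. prob_charge m} \<inter> (\<Inter>A\<in>sets M. {m. measure M A \<le> m (s ` A)}) \<noteq> {}"
  proof (rule compact_imp_fip_image[OF compact_prob_charges])
    fix A
    show "closed {m :: 'a set \<Rightarrow> real. measure M A \<le> m (s ` A)}"
      by (intro closed_Collect_le continuous_on_const continuous_on_product_coordinates)
  next
    fix F assume "finite F" "F \<subseteq> sets M"
    then show "{m. prob_charge m} \<inter> (\<Inter>A\<in>F. {m. measure M A \<le> m (s ` A)}) \<noteq> {}"
      using finitely_additive_image_finite[OF assms, of F s] by auto
  qed
  then show thesis
    using that by blast
qed

section \<open>Lifting Radon measures along subproper maps\<close>

text \<open>
  Equality of the total masses turns the inequality for the complement of a set into the reverse
  inequality for the set.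
\<close>
lemma prob_measure_eqI:
  assumes M: "prob_space M" and N: "prob_space N" and sets: "sets N = sets M"
    and le: "\<And>A. A \<in> sets M \<Longrightarrow> measure M A \<le> measure N A"
  shows "M = N"
proof (rule measure_eqI)
  interpret M: prob_space M by fact
  interpret N: prob_space N by fact
  show "sets M = sets N"
    by (simp add: sets)
  fix A assume A: "A \<in> sets M"
  have "measure M (space M - A) \<le> measure N (space N - A)"
    using le[OF sets.compl_sets[OF A]] sets_eq_imp_space_eq[OF sets] by simp
  then have "measure N A \<le> measure M A"
    using A sets by (simp add: M.prob_compl N.prob_compl)
  then show "emeasure M A = emeasure N A"
    using le[OF A] by (simp add: M.emeasure_eq_measure N.emeasure_eq_measure)
qed

lemma distr_eq_radonI:
  assumes Y: "Hausdorff_space Y" and \<mu>: "\<mu> \<in> radon_prob_measures Y"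
    and N: "prob_space N" and f: "f \<in> N \<rightarrow>\<^sub>M borel_of Y"
    and le: "\<And>K. compactin Y K \<Longrightarrow> measure \<mu> K \<le> measure N (f -` K \<inter> space N)"
  shows "distr N (borel_of Y) f = \<mu>"
proof (rule sym, rule prob_measure_eqI)
  note \<mu>D = radon_prob_measuresD[OF \<mu>]
  interpret \<mu>: prob_space \<mu> by (rule \<mu>D)
  show "prob_space \<mu>" by (rule \<mu>D)
  show D: "prob_space (distr N (borel_of Y) f)"
    using N f by (rule prob_space.prob_space_distr)
  interpret D: prob_space "distr N (borel_of Y) f" by (rule D)
  show "sets (distr N (borel_of Y) f) = sets \<mu>"
    by (simp add: \<mu>D)
  fix B assume B: "B \<in> sets \<mu>"
  show "measure \<mu> B \<le> measure (distr N (borel_of Y) f) B"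
  proof (rule field_le_epsilon)
    fix e :: real assume "0 < e"
    then obtain K where K: "K \<subseteq> B" "compactin Y K" "measure \<mu> (B - K) < e"
      using \<mu>D(4) B by blast
    have Ks: "K \<in> sets \<mu>"
      using compactin_imp_borel[OF Y K(2)] by (simp add: \<mu>D)
    have "measure \<mu> B = measure \<mu> (B - K) + measure \<mu> K"
      using \<mu>.finite_measure_Diff[OF B Ks K(1)] by simp
    also have "\<dots> \<le> e + measure (distr N (borel_of Y) f) K"
      using K le[OF K(2)] Ks f by (simp add: measure_distr \<mu>D)
    also have "measure (distr N (borel_of Y) f) K \<le> measure (distr N (borel_of Y) f) B"
      using B K(1) by (intro D.finite_measure_mono) (simp_all add: \<mu>D)
    finally show "measure \<mu> B \<le> measure (distr N (borel_of Y) f) B + e"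
      by simp
  qed
qed

text \<open>
  A section of \<open>f\<close> on \<open>Z\<close> sends \<open>K\<close> into \<open>Z \<inter> f -` K\<close>. Hence the finitely additive image of \<open>\<mu>\<close> under the
  section gives the closure of that set at least the mass \<open>\<mu> K\<close>, and it is tight as \<open>\<mu>\<close> is. The closure
  is compact, so regularization can only increase its mass.
\<close>
lemma radon_lift:
  assumes X: "Hausdorff_space X" and Y: "Hausdorff_space Y"
    and Z: "f ` Z = topspace Y"
    and comp: "\<And>K. compactin Y K \<Longrightarrow> compactin X (X closure_of (Z \<inter> f -` K))"
    and ZX: "Z \<subseteq> topspace X"
    and \<mu>: "\<mu> \<in> radon_prob_measures Y"
  obtains \<nu> where "\<nu> \<in> radon_prob_measures X"
    "\<And>K. compactin Y K \<Longrightarrow> measure \<mu> K \<le> measure \<nu> (X closure_of (Z \<inter> f -` K))"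
proof -
  note \<mu>D = radon_prob_measuresD[OF \<mu>]
  interpret \<mu>: prob_space \<mu> by (rule \<mu>D)
  define C where "C K = X closure_of (Z \<inter> f -` K)" for K
  define s where "s = inv_into Z f"
  obtain m where m: "prob_charge m" "\<And>A. A \<in> sets \<mu> \<Longrightarrow> measure \<mu> A \<le> m (s ` A)"
    using finitely_additive_image[OF \<mu>D(3)] by blast
  have mC: "measure \<mu> K \<le> m (C K)" if K: "compactin Y K" for K
  proof -
    have "s ` K \<subseteq> Z \<inter> f -` K"
      using compactin_subset_topspace[OF K] unfolding s_def Z[symmetric]
      by (auto simp: inv_into_into f_inv_into_f subset_iff)
    also have "\<dots> \<subseteq> C K"
      unfolding C_def using ZX by (intro closure_of_subset) auto
    finally have "m (s ` K) \<le> m (C K)"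
      by (rule prob_charge_mono[OF m(1)])
    then show ?thesis
      using m(2)[of K] compactin_imp_borel[OF Y K] by (simp add: \<mu>D)
  qed
  interpret Hausdorff_charge X "\<lambda>A. ennreal (m A)"
    using X m(1) by unfold_locales (auto simp: prob_charge_def)
  have nu: "regularization \<in> radon_prob_measures X"
  proof (rule regularization_radon)
    fix e :: real assume "0 < e"
    then obtain K where K: "K \<subseteq> space \<mu>" "compactin Y K" "measure \<mu> (space \<mu> - K) < e"
      using \<mu>D(4) sets.top by blast
    have "measure \<mu> K > 1 - e"
      using K \<mu>.prob_compl[of K] compactin_imp_borel[OF Y K(2)] by (simp add: \<mu>D)
    then have "ennreal (1 - e) \<le> ennreal (m (C K))"
      using mC[OF K(2)] by (intro ennreal_leI) simp
    then show "\<exists>K. compactin X K \<and> ennreal (1 - e) \<le> ennreal (m K)"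
      using comp[OF K(2)] C_def by auto
  qed
  interpret \<nu>: prob_space regularization
    using radon_prob_measuresD(3)[OF nu] .
  have "measure \<mu> K \<le> measure regularization (C K)" if K: "compactin Y K" for K
  proof -
    have "ennreal (m (C K)) \<le> ennreal (measure regularization (C K))"
      using regularization_compact[OF comp[OF K]] by (simp add: \<nu>.emeasure_eq_measure C_def)
    then show ?thesis
      using mC[OF K] by (simp add: ennreal_le_iff)
  qed
  then show thesis
    using that nu unfolding C_def by blast
qed

lemma subproper_map_id: "subproper_map Y Y (\<lambda>y. y)"
  unfolding subproper_map_def
proof (intro conjI exI[of _ "topspace Y"] allI impI)
  fix K assume "precompact_in Y K"
  then show "precompact_in Y (topspace Y \<inter> (\<lambda>y. y) -` K)"
    by (auto simp: precompact_in_def Int_absorb1)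
qed auto

text \<open>
  The lift of a measure is chosen once and for all, independently of the sequences in which the measure
  occurs; this is possible because the bounds on a lift refer to all compact sets of \<open>Y\<close> at once, so they
  suit the compact sets witnessing the tightness of any sequence.
\<close>
lemma weak_skorohod_subproper_image:
  assumes X: "Hausdorff_space X" and Y: "Hausdorff_space Y"
    and wX: "weak_skorohod X" and f: "subproper_map X Y f"
  shows "weak_skorohod Y"
proof -
  obtain Z where cont: "continuous_map X Y f" and Z: "Z \<subseteq> topspace X" "f ` Z = topspace Y"
    and pre: "\<And>K. precompact_in Y K \<Longrightarrow> precompact_in X (Z \<inter> f -` K)"
    using f unfolding subproper_map_def by auto
  define C where "C K = X closure_of (Z \<inter> f -` K)" for K
  have comp: "compactin X (C K)" if K: "compactin Y K" for K
  proof -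
    have "precompact_in Y K"
      using K Y compactin_subset_topspace[OF K]
      by (simp add: precompact_in_def closure_of_closedin compactin_imp_closedin)
    then show ?thesis
      using pre by (simp add: precompact_in_def C_def)
  qed
  have C_sub: "C K \<subseteq> f -` K \<inter> topspace X" if K: "compactin Y K" for K
  proof -
    have "closedin X {x \<in> topspace X. f x \<in> K}"
      using cont compactin_imp_closedin[OF Y K] by (rule closedin_continuous_map_preimage)
    then have "C K \<subseteq> {x \<in> topspace X. f x \<in> K}"
      unfolding C_def using Z(1) by (intro closure_of_minimal) auto
    then show ?thesis by auto
  qed
  have fm: "f \<in> borel_of X \<rightarrow>\<^sub>M borel_of Y"
    by (rule continuous_map_borel[OF cont])
  have "\<exists>\<nu>. \<nu> \<in> radon_prob_measures X \<and> (\<forall>K. compactin Y K \<longrightarrow> measure \<mu> K \<le> measure \<nu> (C K))"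
    if "\<mu> \<in> radon_prob_measures Y" for \<mu>
    using radon_lift[OF X Y Z(2) comp[unfolded C_def] Z(1) that] unfolding C_def by metis
  then obtain lift where lift: "\<And>\<mu>. \<mu> \<in> radon_prob_measures Y \<Longrightarrow> lift \<mu> \<in> radon_prob_measures X"
    "\<And>\<mu> K. \<mu> \<in> radon_prob_measures Y \<Longrightarrow> compactin Y K \<Longrightarrow> measure \<mu> K \<le> measure (lift \<mu>) (C K)"
    by metis
  have distr_lift: "distr (lift \<mu>) (borel_of Y) f = \<mu>" if \<mu>: "\<mu> \<in> radon_prob_measures Y" for \<mu>
  proof (rule distr_eq_radonI[OF Y \<mu>])
    note D = radon_prob_measuresD[OF lift(1)[OF \<mu>]]
    interpret prob_space "lift \<mu>" by (rule D)
    show "prob_space (lift \<mu>)" by (rule D)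
    show fl: "f \<in> lift \<mu> \<rightarrow>\<^sub>M borel_of Y"
      using fm by (simp cong: measurable_cong_sets add: D)
    fix K assume K: "compactin Y K"
    have "measure (lift \<mu>) (C K) \<le> measure (lift \<mu>) (f -` K \<inter> space (lift \<mu>))"
      using C_sub[OF K] compactin_imp_borel[OF Y K] fl
      by (intro finite_measure_mono measurable_sets) (auto simp: D)
    then show "measure \<mu> K \<le> measure (lift \<mu>) (f -` K \<inter> space (lift \<mu>))"
      using lift(2)[OF \<mu> K] by simp
  qed
  have tight: "uniformly_tight X (lift ` M)" if M: "uniformly_tight Y M" for M
    unfolding uniformly_tight_def
  proof (intro conjI allI impI)
    have MR: "M \<subseteq> radon_prob_measures Y"
      using M by (simp add: uniformly_tight_def)
    then show "lift ` M \<subseteq> radon_prob_measures X"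
      using lift(1) by blast
    fix e :: real assume "e > 0"
    then obtain K where K: "compactin Y K" "\<And>\<mu>. \<mu> \<in> M \<Longrightarrow> measure \<mu> (topspace Y - K) < e"
      using M unfolding uniformly_tight_def by blast
    have "measure (lift \<mu>) (topspace X - C K) < e" if \<mu>: "\<mu> \<in> M" for \<mu>
    proof -
      have \<mu>R: "\<mu> \<in> radon_prob_measures Y"
        using \<mu> MR by blast
      note D = radon_prob_measuresD[OF \<mu>R] and L = radon_prob_measuresD[OF lift(1)[OF \<mu>R]]
      have "measure (lift \<mu>) (topspace X - C K) = 1 - measure (lift \<mu>) (C K)"
        using prob_space.prob_compl[OF L(3)] compactin_imp_borel[OF X comp[OF K(1)]]
        by (metis L(1,2))
      also have "\<dots> \<le> 1 - measure \<mu> K"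
        using lift(2)[OF \<mu>R K(1)] by simp
      also have "\<dots> = measure \<mu> (topspace Y - K)"
        using prob_space.prob_compl[OF D(3)] compactin_imp_borel[OF Y K(1)]
        by (metis D(1,2))
      also have "\<dots> < e"
        by (rule K(2)[OF \<mu>])
      finally show ?thesis .
    qed
    then show "\<exists>K. compactin X K \<and> (\<forall>\<nu>\<in>lift ` M. measure \<nu> (topspace X - K) < e)"
      using comp[OF K(1)] by blast
  qed
  obtain \<xi> :: "'a measure \<Rightarrow> real \<Rightarrow> 'a" where
    \<xi>: "\<And>\<nu>. \<nu> \<in> radon_prob_measures X \<Longrightarrow>
        \<xi> \<nu> \<in> unit_lborel \<rightarrow>\<^sub>M borel_of X \<and> distr unit_lborel (borel_of X) (\<xi> \<nu>) = \<nu>"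
    and conv: "\<And>\<nu> :: nat \<Rightarrow> 'a measure. uniformly_tight X (range \<nu>) \<Longrightarrow>
        \<exists>r :: nat \<Rightarrow> nat. strict_mono r \<and>
          (AE t in unit_lborel. \<exists>l. limitin X (\<lambda>n. \<xi> (\<nu> (r n)) t) l sequentially)"
    using wX unfolding weak_skorohod_def by blast
  show ?thesis
    unfolding weak_skorohod_def
  proof (intro exI[of _ "\<lambda>\<mu>. f \<circ> \<xi> (lift \<mu>)"] conjI ballI allI impI)
    fix \<mu> assume \<mu>: "\<mu> \<in> radon_prob_measures Y"
    have x: "\<xi> (lift \<mu>) \<in> unit_lborel \<rightarrow>\<^sub>M borel_of X"
      and dx: "distr unit_lborel (borel_of X) (\<xi> (lift \<mu>)) = lift \<mu>"
      using \<xi>[OF lift(1)[OF \<mu>]] by auto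
    show "f \<circ> \<xi> (lift \<mu>) \<in> unit_lborel \<rightarrow>\<^sub>M borel_of Y"
      by (rule measurable_comp[OF x fm])
    show "distr unit_lborel (borel_of Y) (f \<circ> \<xi> (lift \<mu>)) = \<mu>"
      using distr_distr[OF fm x] distr_lift[OF \<mu>] by (simp add: dx)
  next
    fix \<mu> :: "nat \<Rightarrow> 'b measure" assume "uniformly_tight Y (range \<mu>)"
    then have "uniformly_tight X (range (\<lambda>n. lift (\<mu> n)))"
      using tight by (simp add: image_image[symmetric])
    then obtain r :: "nat \<Rightarrow> nat" where r: "strict_mono r"
      "AE t in unit_lborel. \<exists>l. limitin X (\<lambda>n. \<xi> (lift (\<mu> (r n))) t) l sequentially"
      using conv by blast
    have "AE t in unit_lborel. \<exists>l. limitin Y (\<lambda>n. (f \<circ> \<xi> (lift (\<mu> (r n)))) t) l sequentially"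
      using r(2)
    proof (rule AE_mp, intro AE_I2 impI)
      fix t assume "\<exists>l. limitin X (\<lambda>n. \<xi> (lift (\<mu> (r n))) t) l sequentially"
      then show "\<exists>l. limitin Y (\<lambda>n. (f \<circ> \<xi> (lift (\<mu> (r n)))) t) l sequentially"
        using continuous_map_limit[OF cont] by (fastforce simp: comp_def)
    qed
    with r(1) show "\<exists>r :: nat \<Rightarrow> nat. strict_mono r \<and>
        (AE t in unit_lborel. \<exists>l. limitin Y (\<lambda>n. (f \<circ> \<xi> (lift (\<mu> (r n)))) t) l sequentially)"
      by blast
  qed
qed

theorem theorem10p1:
  fixes Y :: "'b topology"
  assumes "Hausdorff_space Y" and "completely_regular_space Y"
  shows "(weak_skorohod Y \<longrightarrow>
            (\<exists>(X :: 'b topology) f. Hausdorff_space X \<and> weak_skorohod X \<and> subproper_map X Y f)) \<and>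
         ((\<exists>(X :: 'a topology) f. Hausdorff_space X \<and> weak_skorohod X \<and> subproper_map X Y f) \<longrightarrow>
            weak_skorohod Y)"
  using assms(1) subproper_map_id weak_skorohod_subproper_image by blast

end
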